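(* Let $\mathbb{F}$ be a field of characteristic 0 or $p>7$, and let $D^-_{21}$ be the 2-dimensional anti-Jordan quadruple system over $\mathbb{F}$, under the anti-tetrad $[w,x,y,z]=wxyz-zyxw$, with basis the $4\times4$ matrices $$a=\begin{bmatrix} 0 & 0 & 0 & -1 \\ 0 & 0 & 0 & 0 \\ 1 & 0 & 0 & 0 \\ 0 & 0 & 0 & 0 \end{bmatrix},\qquad b=\begin{bmatrix} 0 & 0 & 0 & 0 \\ 0 & 0 & 0 & -1 \\ 0 & 1 & 0 & 0 \\ 0 & 0 & 0 & 0 \end{bmatrix}.$$ Then the universal associative envelope $U(D^-_{21})$ is $\mathbb{Z}$-graded by degree (with the generators $a,b$ in degree 1) and infinite dimensional; in degrees $n\ge6$ it is linearly isomorphic to the (commutative) polynomial algebra $\mathbb{F}[a,b]$, that is, for each $n\ge6$ its homogeneous component of degree $n$ is linearly isomorphic to the homogeneous component of degree $n$ of $\mathbb{F}[a,b]$.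
   Context: In general $D^-_{pq}$ is the space of block matrices $\begin{bmatrix} 0 & 0 & M_{pq} \\ M_{qp} & 0 & 0 \\ 0 & M_{qq} & 0 \end{bmatrix}$ with $M_{pq}$ of size $p\times q$, $M_{qp}$ of size $q\times p$, $M_{qq}$ of size $q\times q$, $M_{pq}=-M_{qp}^t$, and $M_{qq}$ skew-symmetric; it is closed under the anti-tetrad. For a subspace $J$ of a matrix algebra closed under the anti-tetrad, with basis $B$, the universal associative envelope is $U(J)=\mathbb{F}\langle B\rangle/I(G)$, where $\mathbb{F}\langle B\rangle$ is the free unital associative algebra on $B$ and $I(G)$ is the two-sided ideal generated by the elements $wxyz-zyxw-[w,x,y,z]$ for $w,x,y,z\in B$, with $[w,x,y,z]\in J$ computed in $J$ and written as a linear combination of $B$. *)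

theory Defs
  imports
    "Jordan_Normal_Form.VS_Connect"
    "HOL-Algebra.QuotRing"
    "HOL-Library.Poly_Mapping"
begin

section \<open>The anti-tetrad and the spaces $D^-_{pq}$\<close>

definition anti_tetrad :: "'f::field mat \<Rightarrow> 'f mat \<Rightarrow> 'f mat \<Rightarrow> 'f mat \<Rightarrow> 'f mat" where
  "anti_tetrad w x y z = w * x * y * z - z * y * x * w"

text \<open>Rows are split as $p \mid q \mid q$ and columns as $p \mid q \mid q$; the nested
  \<^const>\<open>four_block_mat\<close> below is the $2q \times (p+q)$ lower left part.
  Only the vector space structure of the record is used, the multiplication fields are those of
  \<^const>\<open>module_mat\<close>.\<close>

definition D_minus :: "nat \<Rightarrow> nat \<Rightarrow> ('f::field, 'f mat) module" where
  "D_minus p q = (module_mat TYPE('f) (p + 2 * q) (p + 2 * q))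
    \<lparr>carrier := {four_block_mat
        (0\<^sub>m p (p + q)) Mpq
        (four_block_mat Mqp (0\<^sub>m q q) (0\<^sub>m q p) Mqq) (0\<^sub>m (2 * q) q) | Mpq Mqp Mqq.
      Mpq \<in> carrier_mat p q \<and> Mqp \<in> carrier_mat q p \<and> Mqq \<in> carrier_mat q q \<and>
      Mpq = - transpose_mat Mqp \<and> transpose_mat Mqq = - Mqq}\<rparr>"

subsection \<open>The case $p = 2$, $q = 1$\<close>

lemma D_minus_2_1:
  fixes a b :: "'f::field mat"
  assumes char: "CHAR('f) \<noteq> 2"
    and a: "a = mat_of_rows_list 4 [[0,0,0,-1],[0,0,0,0],[1,0,0,0],[0,0,0,0]]"
    and b: "b = mat_of_rows_list 4 [[0,0,0,0],[0,0,0,-1],[0,1,0,0],[0,0,0,0]]"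
  shows carrier_D_minus_2_1: "carrier (D_minus 2 1) = {x \<cdot>\<^sub>m a + y \<cdot>\<^sub>m b | x y. True}"
    and vectorspace_D_minus_2_1: "vectorspace class_ring (D_minus 2 1 :: ('f, 'f mat) module)"
    and basis_D_minus_2_1: "vectorspace.basis class_ring (D_minus 2 1) {a, b}"
    and dim_D_minus_2_1: "vectorspace.dim class_ring (D_minus 2 1 :: ('f, 'f mat) module) = 2"
    and closed_D_minus_2_1: "\<And>w x y z :: 'f mat.
      w \<in> carrier (D_minus 2 1) \<Longrightarrow> x \<in> carrier (D_minus 2 1) \<Longrightarrow>
      y \<in> carrier (D_minus 2 1) \<Longrightarrow> z \<in> carrier (D_minus 2 1) \<Longrightarrow>
      anti_tetrad w x y z \<in> carrier (D_minus 2 1)"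
proof -
  define m :: "'f \<Rightarrow> 'f \<Rightarrow> 'f mat" where
    "m x y = mat_of_rows_list 4 [[0,0,0,-x],[0,0,0,-y],[x,y,0,0],[0,0,0,0]]" for x y
  note num = numeral_eq_Suc less_Suc_eq mat_of_rows_list_def
  have m: "x \<cdot>\<^sub>m a + y \<cdot>\<^sub>m b = m x y" for x y
    by (rule eq_matI) (auto simp: a b m_def num)
  have m_carrier: "m x y \<in> carrier_mat 4 4" for x y
    by (simp add: m_def num)
  have m_add: "m x y + m x' y' = m (x + x') (y + y')" for x y x' y'
    by (rule eq_matI) (auto simp: m_def num)
  have m_smult: "c \<cdot>\<^sub>m m x y = m (c * x) (c * y)" for c x y
    by (rule eq_matI) (auto simp: m_def num)
  have m_zero: "m 0 0 = 0\<^sub>m 4 4"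
    by (rule eq_matI) (auto simp: m_def num)
  have ab: "a = m 1 0" "b = m 0 1"
    by (simp_all add: a b m_def)
  have m_inj: "m x y = m x' y' \<longleftrightarrow> x = x' \<and> y = y'" for x y x' y'
  proof
    assume eq: "m x y = m x' y'"
    have "m x y $$ (2, 0) = x" "m x y $$ (2, 1) = y" for x y
      by (simp_all add: m_def num)
    then show "x = x' \<and> y = y'" using eq by metis
  qed simp
  have m_prod: "m x y * m x' y' * m x'' y'' = 0\<^sub>m 4 4" for x y x' y' x'' y''
    by (rule eq_matI) (auto simp: m_def num scalar_prod_def)
  have carrier_eq: "carrier (D_minus 2 1) = {m x y | x y. True}"
  proof (intro equalityI subsetI)
    fix M :: "'f mat" assume "M \<in> carrier (D_minus 2 1)"
    then obtain P Q R where Q: "Q \<in> carrier_mat 1 2" and R: "R \<in> carrier_mat 1 1"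
      and P: "P = - transpose_mat Q" and RR: "transpose_mat R = - R"
      and M: "M = four_block_mat (0\<^sub>m 2 3) P
        (four_block_mat Q (0\<^sub>m 1 1) (0\<^sub>m 1 2) R) (0\<^sub>m 2 1)"
      by (auto simp: D_minus_def eval_nat_numeral)
    have "transpose_mat R $$ (0,0) = (- R) $$ (0,0)" by (simp add: RR)
    then have "2 * R $$ (0,0) = 0" using R by (simp add: algebra_simps)
    moreover have "(2::'f) \<noteq> 0"
    proof
      assume "(2::'f) = 0"
      then have "of_nat 2 = (0::'f)" by simp
      then have "CHAR('f) dvd 2" by (simp only: of_nat_eq_0_iff_char_dvd)
      then have "CHAR('f) = 1 \<or> CHAR('f) = 2" by (metis two_is_prime_nat prime_nat_iff)
      then show False using char CHAR_not_1 by auto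
    qed
    ultimately have R0: "R $$ (0,0) = 0" by simp
    have "M = m (Q $$ (0,0)) (Q $$ (0,1))"
      by (rule eq_matI)
        (use Q R R0 in \<open>auto simp: M P m_def num four_block_mat_def Let_def\<close>)
    then show "M \<in> {m x y | x y. True}" by blast
  next
    fix M :: "'f mat" assume "M \<in> {m x y | x y. True}"
    then obtain x y where M: "M = m x y" by auto
    let ?Q = "mat_of_rows_list 2 [[x, y]]"
    have "M = four_block_mat (0\<^sub>m 2 3) (- transpose_mat ?Q)
        (four_block_mat ?Q (0\<^sub>m 1 1) (0\<^sub>m 1 2) (0\<^sub>m 1 1)) (0\<^sub>m 2 1)"
      unfolding M by (rule eq_matI) (auto simp: m_def num four_block_mat_def Let_def)
    moreover have "?Q \<in> carrier_mat 1 2" by (simp add: mat_of_rows_list_def)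
    moreover have "transpose_mat (0\<^sub>m 1 1) = - (0\<^sub>m 1 1 :: 'f mat)" by (rule eq_matI) auto
    ultimately show "M \<in> carrier (D_minus 2 1)"
      unfolding D_minus_def
      by (simp add: eval_nat_numeral)
        (rule exI[of _ ?Q], rule exI[of _ "0\<^sub>m 1 1"],
          simp add: eval_nat_numeral)
  qed
  show "carrier (D_minus 2 1) = {x \<cdot>\<^sub>m a + y \<cdot>\<^sub>m b | x y. True}"
    by (simp only: carrier_eq m)
  note carrier_eq = carrier_eq carrier_eq[unfolded One_nat_def]
  let ?V = "D_minus 2 1 :: ('f, 'f mat) module"
  have V: "?V = (module_mat TYPE('f) 4 4)\<lparr>carrier := carrier ?V\<rparr>"
    by (simp add: D_minus_def)
  interpret M: vectorspace "class_ring :: 'f ring" "module_mat TYPE('f) 4 4"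
    by (rule matrix_vs)
  have "subspace class_ring (carrier ?V) (module_mat TYPE('f) 4 4)"
    unfolding subspace_def submodule_def carrier_eq
    using M.vectorspace_axioms M.module_axioms m_carrier
    by (auto simp: module_mat_simps m_add m_smult m_zero[symmetric] m_inj)
  then show vs: "vectorspace class_ring ?V"
    using M.subspace_is_vs V by metis
  interpret D: vectorspace "class_ring :: 'f ring" ?V by (rule vs)
  have ab_V: "{a, b} \<subseteq> carrier ?V" by (auto simp: carrier_eq ab)
  have ab_ne: "a \<noteq> b" by (simp add: ab m_inj)
  have ops: "add ?V = (+)" "smult ?V = (\<cdot>\<^sub>m)" "zero ?V = 0\<^sub>m 4 4"
    by (subst V, simp add: module_mat_simps)+
  note ops = ops ops[unfolded One_nat_def]
  have sm: "c \<cdot>\<^sub>m a = m c 0" "c \<cdot>\<^sub>m b = m 0 c" for c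
    by (simp_all add: ab m_smult)
  have lc: "D.lincomb c {a, b} = m (c a) (c b)" for c
  proof -
    have "m x y \<in> carrier ?V" for x y by (auto simp: carrier_eq)
    then show ?thesis
      unfolding D.lincomb_def
      by (subst D.M.finsum_insert; (subst D.M.finsum_insert)?)
        (use ab_ne in \<open>auto simp: ops sm m_add m_zero[symmetric]
          D.M.finsum_empty[unfolded One_nat_def]\<close>)
  qed
  note lc = lc lc[unfolded One_nat_def]
  have gen: "D.gen_set {a, b}"
  proof -
    have "D.span {a, b} = {D.lincomb c {a, b} | c. c \<in> {a, b} \<rightarrow> carrier class_ring}"
      using D.finite_span[of "{a,b}"] ab_V by auto
    also have "\<dots> = {m x y | x y. True}"
    proof (intro equalityI subsetI)
      fix M assume "M \<in> {m x y | x y. True}"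
      then obtain x y where "M = m x y" by auto
      then have "M = D.lincomb (\<lambda>v. if v = a then x else y) {a, b}"
        using ab_ne by (simp add: lc)
      then show "M \<in> {D.lincomb c {a, b} | c. c \<in> {a, b} \<rightarrow> carrier class_ring}" by auto
    qed (auto simp: lc)
    finally show ?thesis by (simp add: carrier_eq)
  qed
  have "D.lin_indpt {a, b}"
  proof
    assume "D.lin_dep {a, b}"
    then obtain c v where "D.lincomb c {a, b} = \<zero>\<^bsub>?V\<^esub>" "v \<in> {a, b}" "c v \<noteq> 0"
      using D.finite_lin_dep[of "{a, b}"] ab_V by auto
    then show False by (auto simp: lc ops m_zero[symmetric] m_inj)
  qed
  with gen show basis: "D.basis {a, b}"
    using ab_V unfolding D.basis_def by blast
  show "D.dim = 2"
    using D.dim_basis[OF _ basis] ab_ne by simp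
  show "anti_tetrad w x y z \<in> carrier ?V"
    if "w \<in> carrier ?V" "x \<in> carrier ?V" "y \<in> carrier ?V" "z \<in> carrier ?V" for w x y z
  proof -
    have "anti_tetrad w x y z = 0\<^sub>m 4 4"
      using that by (auto simp: carrier_eq anti_tetrad_def m_prod left_mult_zero_mat[OF m_carrier])
    also have "\<dots> = m 0 0" by (simp add: m_zero)
    finally show ?thesis unfolding carrier_eq by auto
  qed
qed


section \<open>Free associative and polynomial algebras\<close>

text \<open>Words form a monoid under concatenation. With this instance the convolution product of
  \<^typ>\<open>'b list \<Rightarrow>\<^sub>0 'f\<close> from \<^theory>\<open>HOL-Library.Poly_Mapping\<close> is the product of noncommutative
  polynomials.\<close>

instantiation list :: (type) monoid_add
begin

definition zero_list :: "'a list" where "zero_list = []"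
definition plus_list :: "'a list \<Rightarrow> 'a list \<Rightarrow> 'a list" where "plus_list = (@)"

instance by standard (simp_all add: zero_list_def plus_list_def)

end

definition free_algebra :: "'b set \<Rightarrow> ('f::field, 'b list \<Rightarrow>\<^sub>0 'f) module" where
  "free_algebra B = \<lparr>carrier = {p. \<forall>w\<in>Poly_Mapping.keys p. set w \<subseteq> B},
     mult = (*), one = 1, zero = 0, add = (+),
     smult = (\<lambda>c p. Poly_Mapping.single 0 c * p)\<rparr>"

definition free_homogeneous :: "'b set \<Rightarrow> int \<Rightarrow> ('b list \<Rightarrow>\<^sub>0 'f::field) set" where
  "free_homogeneous B k =
    {p \<in> carrier (free_algebra B). \<forall>w\<in>Poly_Mapping.keys p. int (length w) = k}"

text \<open>The commutative polynomial algebra with set of indeterminates \<open>B\<close>; a monomial is its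
  exponent function.\<close>

definition poly_algebra :: "'b set \<Rightarrow> ('f::field, ('b \<Rightarrow>\<^sub>0 nat) \<Rightarrow>\<^sub>0 'f) module" where
  "poly_algebra B = \<lparr>carrier = {p. \<forall>m\<in>Poly_Mapping.keys p. Poly_Mapping.keys m \<subseteq> B},
     mult = (*), one = 1, zero = 0, add = (+),
     smult = (\<lambda>c p. Poly_Mapping.single 0 c * p)\<rparr>"

definition poly_homogeneous :: "'b set \<Rightarrow> int \<Rightarrow> (('b \<Rightarrow>\<^sub>0 nat) \<Rightarrow>\<^sub>0 'f::field) set" where
  "poly_homogeneous B k =
    {p \<in> carrier (poly_algebra B). \<forall>m\<in>Poly_Mapping.keys p.
       int (\<Sum>x\<in>Poly_Mapping.keys m. Poly_Mapping.lookup m x) = k}"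


section \<open>The universal associative envelope\<close>

text \<open>\<open>J\<close> is a space of matrices closed under the anti-tetrad and \<open>B\<close> a finite basis of \<open>J\<close>, whose
  elements serve as letters. The coefficient function \<open>c\<close> expresses $[w,x,y,z] \in J$ in that
  basis (and is thereby unique on \<open>B\<close>).\<close>

definition envelope_relators ::
    "('f::field, 'f mat) module \<Rightarrow> 'f mat set \<Rightarrow> ('f mat list \<Rightarrow>\<^sub>0 'f) set" where
  "envelope_relators J B =
    {Poly_Mapping.single [w, x, y, z] 1 - Poly_Mapping.single [z, y, x, w] 1
       - (\<Sum>v\<in>B. Poly_Mapping.single [v] (c v)) | w x y z c.
     w \<in> B \<and> x \<in> B \<and> y \<in> B \<and> z \<in> B \<and>
     anti_tetrad w x y z = module.lincomb J c B}"

definition envelope_ideal ::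
    "('f::field, 'f mat) module \<Rightarrow> 'f mat set \<Rightarrow> ('f mat list \<Rightarrow>\<^sub>0 'f) set" where
  "envelope_ideal J B = genideal (free_algebra B) (envelope_relators J B)"

definition envelope_class ::
    "('f::field, 'f mat) module \<Rightarrow> 'f mat set \<Rightarrow> ('f mat list \<Rightarrow>\<^sub>0 'f)
      \<Rightarrow> ('f mat list \<Rightarrow>\<^sub>0 'f) set" where
  "envelope_class J B p = a_r_coset (free_algebra B) (envelope_ideal J B) p"

text \<open>The ring is the quotient ring \<^term>\<open>free_algebra B Quot envelope_ideal J B\<close>; only the scalar
  multiplication is added, by the pattern of \<^const>\<open>rcoset_mult\<close>.\<close>

definition universal_envelope ::
    "('f::field, 'f mat) module \<Rightarrow> 'f mat set \<Rightarrow> ('f, ('f mat list \<Rightarrow>\<^sub>0 'f) set) module" where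
  "universal_envelope J B = ring.extend (free_algebra B Quot envelope_ideal J B)
    (module.fields (\<lambda>c X. \<Union>p\<in>X. envelope_class J B (c \<odot>\<^bsub>free_algebra B\<^esub> p)))"

definition envelope_component ::
    "('f::field, 'f mat) module \<Rightarrow> 'f mat set \<Rightarrow> int \<Rightarrow> ('f mat list \<Rightarrow>\<^sub>0 'f) set set" where
  "envelope_component J B k = envelope_class J B ` free_homogeneous B k"


section \<open>Graded algebras and linear isomorphism\<close>

definition assoc_algebra :: "('f, 'k) ring_scheme \<Rightarrow> ('f, 'a, 'm) module_scheme \<Rightarrow> bool" where
  "assoc_algebra K A \<longleftrightarrow> ring A \<and> vectorspace K A \<and>
    (\<forall>c\<in>carrier K. \<forall>x\<in>carrier A. \<forall>y\<in>carrier A.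
       c \<odot>\<^bsub>A\<^esub> (x \<otimes>\<^bsub>A\<^esub> y) = (c \<odot>\<^bsub>A\<^esub> x) \<otimes>\<^bsub>A\<^esub> y \<and>
       c \<odot>\<^bsub>A\<^esub> (x \<otimes>\<^bsub>A\<^esub> y) = x \<otimes>\<^bsub>A\<^esub> (c \<odot>\<^bsub>A\<^esub> y))"

definition Z_graded_algebra ::
    "('f, 'k) ring_scheme \<Rightarrow> ('f, 'a, 'm) module_scheme \<Rightarrow> (int \<Rightarrow> 'a set) \<Rightarrow> bool" where
  "Z_graded_algebra K A V \<longleftrightarrow> assoc_algebra K A \<and>
    (\<forall>k. subspace K (V k) A) \<and>
    (\<forall>x\<in>carrier A. \<exists>!c. (\<forall>k. c k \<in> V k) \<and> finite {k. c k \<noteq> \<zero>\<^bsub>A\<^esub>} \<and>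
       x = (\<Oplus>\<^bsub>A\<^esub>k\<in>{k. c k \<noteq> \<zero>\<^bsub>A\<^esub>}. c k)) \<and>
    \<one>\<^bsub>A\<^esub> \<in> V 0 \<and>
    (\<forall>i j. \<forall>x\<in>V i. \<forall>y\<in>V j. x \<otimes>\<^bsub>A\<^esub> y \<in> V (i + j))"

definition linearly_isomorphic ::
    "('f, 'k) ring_scheme \<Rightarrow> ('f, 'a, 'm) module_scheme \<Rightarrow> ('f, 'b, 'n) module_scheme \<Rightarrow> bool" where
  "linearly_isomorphic K V W \<longleftrightarrow>
    (\<exists>T. linear_map K V W T \<and> bij_betw T (carrier V) (carrier W))"

end

theory Submission
  imports Defs
begin

text \<open>All anti-tetrads of the basis matrices vanish, so the defining relations read
  $wxyz = zyxw$ and the envelope is the monoid algebra of the words in $a, b$ modulo reversal of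
  factors of length four. These relations are homogeneous, which gives the grading. On words of
  length six the three possible reversals generate the alternating group on the positions; as
  there are only two letters, words of length at least six with the same number of occurrences of
  each letter are therefore equivalent. Hence abelianization, which always factors through the
  envelope, is injective in degrees at least six. The powers of $a$ stay linearly independent
  under it, so the dimension is infinite.\<close>

section \<open>Words modulo reversal of factors of length four\<close>

definition reversal_step :: "'b list \<Rightarrow> 'b list \<Rightarrow> bool" where
  "reversal_step u v \<longleftrightarrow>
    (\<exists>p w x y z q. u = p @ [w, x, y, z] @ q \<and> v = p @ [z, y, x, w] @ q)"

abbreviation reversal_equiv :: "'b list \<Rightarrow> 'b list \<Rightarrow> bool" where
  "reversal_equiv \<equiv> reversal_step\<^sup>*\<^sup>*"

text \<open>A factor of length four fits into a block of six letters at three places. Each reversal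
  is a product of two disjoint transpositions, hence even, which is why rotations of three letters
  rather than swaps are derived from them.\<close>

lemma window_reversal:
  "reversal_equiv (p @ [r, s, t, x, y, z] @ q) (p @ [x, t, s, r, y, z] @ q)"
  "reversal_equiv (p @ [r, s, t, x, y, z] @ q) (p @ [r, y, x, t, s, z] @ q)"
  "reversal_equiv (p @ [r, s, t, x, y, z] @ q) (p @ [r, s, z, y, x, t] @ q)"
proof -
  have "reversal_equiv (p @ [w, x, y, z] @ q) (p @ [z, y, x, w] @ q)" for p q and w x y z :: 'a
    unfolding reversal_step_def by blast
  from this[of p r s t x "[y, z] @ q"] this[of "p @ [r]" s t x y "[z] @ q"]
    this[of "p @ [r, s]" t x y z q]
  show "reversal_equiv (p @ [r, s, t, x, y, z] @ q) (p @ [x, t, s, r, y, z] @ q)"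
    "reversal_equiv (p @ [r, s, t, x, y, z] @ q) (p @ [r, y, x, t, s, z] @ q)"
    "reversal_equiv (p @ [r, s, t, x, y, z] @ q) (p @ [r, s, z, y, x, t] @ q)"
    by simp_all
qed

text \<open>The sequences of reversals below come from a breadth first search in the alternating group
  on the six positions.\<close>

lemma rotate_0:
  "reversal_equiv (p @ [r, s, t, x, y, z] @ q)
    (p @ [t, r, s, x, y, z] @ q)"
  by (rule rtranclp_trans[OF window_reversal(2)],
    rule rtranclp_trans[OF window_reversal(3)],
    rule rtranclp_trans[OF window_reversal(2)],
    rule rtranclp_trans[OF window_reversal(3)],
    rule rtranclp_trans[OF window_reversal(1)],
    rule rtranclp_trans[OF window_reversal(2)],
    rule rtranclp_trans[OF window_reversal(1)],
    rule window_reversal(3))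

lemma rotate_1:
  "reversal_equiv (p @ [r, s, t, x, y, z] @ q)
    (p @ [r, x, s, t, y, z] @ q)"
  by (rule rtranclp_trans[OF window_reversal(1)],
    rule rtranclp_trans[OF window_reversal(2)],
    rule rtranclp_trans[OF window_reversal(3)],
    rule rtranclp_trans[OF window_reversal(2)],
    rule rtranclp_trans[OF window_reversal(3)],
    rule rtranclp_trans[OF window_reversal(2)],
    rule rtranclp_trans[OF window_reversal(1)],
    rule rtranclp_trans[OF window_reversal(3)],
    rule window_reversal(2))

lemma rotate_2:
  "reversal_equiv (p @ [r, s, t, x, y, z] @ q)
    (p @ [r, s, y, t, x, z] @ q)"
  by (rule rtranclp_trans[OF window_reversal(1)],
    rule rtranclp_trans[OF window_reversal(3)],
    rule rtranclp_trans[OF window_reversal(1)],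
    rule rtranclp_trans[OF window_reversal(2)],
    rule rtranclp_trans[OF window_reversal(3)],
    rule rtranclp_trans[OF window_reversal(2)],
    rule rtranclp_trans[OF window_reversal(3)],
    rule rtranclp_trans[OF window_reversal(1)],
    rule window_reversal(2))

lemma rotate_3:
  "reversal_equiv (p @ [r, s, t, x, y, z] @ q)
    (p @ [r, s, t, z, x, y] @ q)"
  by (rule rtranclp_trans[OF window_reversal(1)],
    rule rtranclp_trans[OF window_reversal(3)],
    rule rtranclp_trans[OF window_reversal(2)],
    rule rtranclp_trans[OF window_reversal(3)],
    rule rtranclp_trans[OF window_reversal(1)],
    rule rtranclp_trans[OF window_reversal(2)],
    rule rtranclp_trans[OF window_reversal(1)],
    rule window_reversal(2))

text \<open>Three further letters complete the triple to a block of six. The triple has offset 0, 1,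
  2 or 3 in that block, according to how many of these letters must come from
  \<open>p\<close>.\<close>

lemma rotate_three:
  assumes "length p + length q \<ge> 3"
  shows "reversal_equiv (p @ [x, y, z] @ q) (p @ [z, x, y] @ q)"
proof -
  consider "length q \<ge> 3" | "length p \<ge> 1" "length q = 2"
    | "length p \<ge> 2" "length q = 1" | "length p \<ge> 3" "length q = 0"
    using assms by linarith
  then show ?thesis
  proof cases
    case 1
    then obtain r s t q' where "q = [r, s, t] @ q'"
      by (auto simp: numeral_3_eq_3 Suc_le_length_iff)
    then show ?thesis using rotate_0[of p x y z r s t q'] by simp
  next
    case 2
    then obtain p' r s t where "p = p' @ [r]" "q = [s, t]"
      by (cases p rule: rev_cases) (auto simp: numeral_2_eq_2 length_Suc_conv)
    then show ?thesis using rotate_1[of p' r x y z s t "[]"] by simp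
  next
    case 3
    then obtain p1 s t where "p = p1 @ [s]" "q = [t]"
      by (cases p rule: rev_cases) (auto simp: length_Suc_conv)
    moreover from this obtain p' r where "p1 = p' @ [r]"
      using 3 by (cases p1 rule: rev_cases) auto
    ultimately show ?thesis using rotate_2[of p' r s x y z t "[]"] by simp
  next
    case 4
    then obtain p1 t where "p = p1 @ [t]" by (cases p rule: rev_cases) auto
    moreover from this obtain p2 s where "p1 = p2 @ [s]"
      using 4 by (cases p1 rule: rev_cases) auto
    moreover from calculation obtain p' r where "p2 = p' @ [r]"
      using 4 by (cases p2 rule: rev_cases) auto
    ultimately show ?thesis using rotate_3[of p' r s t x y z "[]"] 4 by simp
  qed
qed

text \<open>Over two letters a rotation of three adjacent letters can play the role of a
  transposition, as two of the letters agree.\<close>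

lemma swap_adjacent:
  assumes len: "length p + length q \<ge> 4"
    and set: "set (p @ [x, y] @ q) \<subseteq> {a, b}"
  shows "reversal_equiv (p @ [x, y] @ q) (p @ [y, x] @ q)"
proof (cases "x = y")
  case False
  show ?thesis
  proof (cases q)
    case (Cons z q')
    have rot: "reversal_equiv (p @ [u, v, w] @ q') (p @ [w, u, v] @ q')" for u v w
      using len Cons by (intro rotate_three) simp
    \<comment> \<open>If \<open>z = y\<close>, one rotation takes xyy to yxy; if
      \<open>z = x\<close>, two rotations take xyx through xxy to yxx. When \<open>q\<close> is
      empty, the letter to the left of the pair plays the part of \<open>z\<close>.\<close>
    have "z = x \<or> z = y" using set False Cons by auto
    then show ?thesis
      using rot[of x y z] rtranclp_trans[OF rot[of x y z] rot] Cons by auto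
  next
    case Nil
    then obtain p' z where p: "p = p' @ [z]" using len by (cases p rule: rev_cases) auto
    have rot: "reversal_equiv (p' @ [u, v, w] @ []) (p' @ [w, u, v] @ [])" for u v w
      using len Nil p by (intro rotate_three) simp
    have "z = x \<or> z = y" using set False p by auto
    then show ?thesis
      using rot[of z x y] rtranclp_trans[OF rot[of z x y] rot] Nil p by auto
  qed
qed simp

text \<open>The letter \<open>x\<close> crosses \<open>u\<close> by adjacent swaps, the last letter
  of \<open>u\<close> first. Letters of \<open>u\<close> not yet crossed are moved into the prefix,
  so the length condition of each swap is about the unchanged total length.\<close>

lemma move_to_front:
  assumes "length (p @ u @ x # v) \<ge> 6" "set (p @ u @ x # v) \<subseteq> {a, b}"
  shows "reversal_equiv (p @ u @ x # v) (p @ x # u @ v)"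
  using assms
proof (induction u arbitrary: p)
  case (Cons y u)
  have "reversal_equiv ((p @ [y]) @ u @ x # v) ((p @ [y]) @ x # u @ v)"
    using Cons.prems by (intro Cons.IH) auto
  moreover have "reversal_equiv (p @ [y, x] @ u @ v) (p @ [x, y] @ u @ v)"
    using Cons.prems by (intro swap_adjacent[where a = a and b = b]) auto
  ultimately show ?case by simp
qed simp

text \<open>Selection sort: the first letter of \<open>u\<close> is found in \<open>v\<close> and
  brought to the front, and the remaining letters are matched by induction.\<close>

lemma reversal_equiv_if_mset_eq:
  assumes "mset u = mset v" "length u \<ge> 6" "set u \<subseteq> {a, b}"
  shows "reversal_equiv u v"
proof -
  \<comment> \<open>The prefix \<open>p\<close> collects the letters already matched, which keeps
    the total length at six or more while \<open>u\<close> shrinks.\<close>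
  have "reversal_equiv (p @ u) (p @ v)"
    if "mset u = mset v" "length (p @ u) \<ge> 6" "set (p @ u) \<subseteq> {a, b}" for p
    using that
  proof (induction u arbitrary: p v)
    case (Cons x u)
    have eq: "mset v = add_mset x (mset u)" using Cons.prems(1) by simp
    then have "x \<in> set v" by (metis set_mset_mset union_single_eq_member)
    then obtain v1 v2 where v: "v = v1 @ x # v2" by (meson split_list)
    have sets: "set v = set (x # u)" and len: "length v = length (x # u)"
      using Cons.prems(1) by (metis mset_eq_setD, metis mset_eq_length)
    have "reversal_equiv ((p @ [x]) @ u) ((p @ [x]) @ v1 @ v2)"
      using Cons.prems eq v by (intro Cons.IH) auto
    moreover have "reversal_equiv (p @ x # v1 @ v2) (p @ v1 @ x # v2)"
    proof -
      \<comment> \<open>\<open>move_to_front\<close> yields the opposite direction; a reversal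
        undoes itself, so the closure is symmetric.\<close>
      have "symp reversal_equiv"
        unfolding reversal_step_def by (intro symp_rtranclp sympI) blast
      moreover have "reversal_equiv (p @ v1 @ x # v2) (p @ x # v1 @ v2)"
        using Cons.prems(2,3) sets len v by (intro move_to_front) auto
      ultimately show ?thesis by (rule sympD)
    qed
    ultimately show ?case using v by simp
  qed simp
  from this[of "[]"] show ?thesis using assms by simp
qed

section \<open>Convolution algebras\<close>

lemma sum_single_lookup:
  fixes p :: "'a \<Rightarrow>\<^sub>0 'c::comm_monoid_add"
  shows "(\<Sum>w\<in>Poly_Mapping.keys p. Poly_Mapping.single w (Poly_Mapping.lookup p w)) = p"
  by (rule poly_mapping_eqI)
    (simp add: lookup_sum lookup_single when_def not_in_keys_iff_lookup_eq_zero)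

text \<open>The case of a single term is limited to the support of \<open>p\<close>, so that bounds
  on the letters and the length of words remain available there.\<close>

lemma poly_mapping_single_induct [case_names zero add single]:
  fixes p :: "'a \<Rightarrow>\<^sub>0 'c::comm_monoid_add"
  assumes "P 0" "\<And>p q. P p \<Longrightarrow> P q \<Longrightarrow> P (p + q)"
    and "\<And>w c. w \<in> Poly_Mapping.keys p \<Longrightarrow> P (Poly_Mapping.single w c)"
  shows "P p"
proof -
  have "P (\<Sum>w\<in>A. Poly_Mapping.single w (Poly_Mapping.lookup p w))"
    if "finite A" "A \<subseteq> Poly_Mapping.keys p" for A
    using that by (induction A) (auto intro: assms)
  from this[OF finite_keys order.refl] show ?thesis by (simp add: sum_single_lookup)
qed

section \<open>Linear extensions of maps on monomials\<close>

text \<open>The linear extension of \<open>h\<close> to formal combinations. With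
  \<open>content\<close> for \<open>h\<close> it is abelianization, and with
  \<open>sorted_word\<close> it produces preimages under abelianization.\<close>

definition push :: "('a \<Rightarrow> 'b) \<Rightarrow> ('a \<Rightarrow>\<^sub>0 'c) \<Rightarrow> 'b \<Rightarrow>\<^sub>0 'c::comm_monoid_add" where
  "push h p = (\<Sum>w\<in>Poly_Mapping.keys p. Poly_Mapping.single (h w) (Poly_Mapping.lookup p w))"

lemma push_zero [simp]: "push h 0 = 0"
  by (simp add: push_def)

lemma push_single [simp]: "push h (Poly_Mapping.single w c) = Poly_Mapping.single (h w) c"
  by (cases "c = 0") (simp_all add: push_def)

lemma push_add: "push h (p + q) = push h p + push h q"
  unfolding push_def by (rule setsum_keys_plus_distrib) (simp_all add: single_add)

lemma push_uminus: "push h (- p) = - push h (p :: 'a \<Rightarrow>\<^sub>0 'c::ab_group_add)"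
  using push_add[of h p "- p"] by (simp add: eq_neg_iff_add_eq_0 add.commute)

lemma push_diff: "push h (p - q) = push h p - push h (q :: 'a \<Rightarrow>\<^sub>0 'c::ab_group_add)"
  using push_add[of h p "- q"] by (simp add: push_uminus)

text \<open>Both sides are additive in \<open>p\<close> and in \<open>q\<close>, so two nested
  inductions reduce the claim to products of single terms.\<close>

lemma push_mult:
  fixes p q :: "'a::monoid_add \<Rightarrow>\<^sub>0 'c::semiring_0"
    and h :: "'a \<Rightarrow> 'b::monoid_add"
  assumes "\<And>u v. h (u + v) = h u + h v"
  shows "push h (p * q) = push h p * push h q"
proof (induction p rule: poly_mapping_single_induct)
  case (single u c)
  show ?case
    by (induction q rule: poly_mapping_single_induct)
      (simp_all add: push_add distrib_left mult_single assms)
qed (simp_all add: push_add distrib_right)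

lemma push_push: "push g (push h p) = push (g \<circ> h) p"
  by (induction p rule: poly_mapping_single_induct) (simp_all add: push_add)

lemma push_eq_self:
  assumes "\<And>w. w \<in> Poly_Mapping.keys p \<Longrightarrow> h w = w"
  shows "push h p = p"
  using assms sum_single_lookup[of p] by (simp add: push_def)

lemma keys_push: "Poly_Mapping.keys (push h p) \<subseteq> h ` Poly_Mapping.keys p"
proof -
  have "Poly_Mapping.keys (\<Sum>w\<in>A. Poly_Mapping.single (h w) (Poly_Mapping.lookup p w)) \<subseteq> h ` A"
    if "finite A" for A
    using that by (induction A) (use keys_add in \<open>fastforce split: if_splits\<close>)+
  then show ?thesis by (simp add: push_def)
qed

lemma lookup_single_0_mult:
  "Poly_Mapping.lookup (Poly_Mapping.single 0 c * p) k = c * Poly_Mapping.lookup (p :: _ \<Rightarrow>\<^sub>0 'c::semiring_1) k"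
  by (simp add: mult_map_scale_conv_mult[symmetric] map.rep_eq when_def)

lemma single_0_mult_commute:
  fixes p :: "'a::monoid_add \<Rightarrow>\<^sub>0 'c::comm_semiring_1"
  shows "Poly_Mapping.single 0 c * p = p * Poly_Mapping.single 0 c"
  by (induction p rule: poly_mapping_single_induct)
    (simp_all add: distrib_left distrib_right mult_single mult.commute)

text \<open>Stated for arbitrary \<open>m\<close> and \<open>e\<close> so that it covers homogeneous
  components, which are subspaces but in general not subrings.\<close>

lemma vectorspace_convolution:
  fixes C :: "('a::monoid_add \<Rightarrow>\<^sub>0 'f::field) set"
  assumes "0 \<in> C" "\<And>p q. p \<in> C \<Longrightarrow> q \<in> C \<Longrightarrow> p + q \<in> C"
    and smult: "\<And>c p. p \<in> C \<Longrightarrow> Poly_Mapping.single 0 c * p \<in> C"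
  shows "vectorspace class_ring \<lparr>carrier = C, mult = m, one = e, zero = 0, add = (+),
    smult = (\<lambda>c p. Poly_Mapping.single 0 c * p)\<rparr>"
proof -
  have uminus: "- p \<in> C" if "p \<in> C" for p
    using smult[OF that, of "- 1"] by (simp add: single_uminus)
  show ?thesis
    unfolding vectorspace_def
  proof (intro conjI moduleI abelian_groupI)
    show "cring (class_ring :: 'f ring)" "field (class_ring :: 'f ring)"
      using class_field by (auto simp: field_def domain_def)
  qed (use assms uminus in \<open>auto simp: algebra_simps single_add mult_single
        mult.assoc[symmetric] intro: bexI[of _ "- _"]\<close>)
qed

section \<open>Homogeneous parts of noncommutative polynomials\<close>

definition homog :: "int \<Rightarrow> ('b list \<Rightarrow>\<^sub>0 'f) \<Rightarrow> 'b list \<Rightarrow>\<^sub>0 'f::zero" where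
  "homog k = Poly_Mapping.mapp (\<lambda>w c. c when int (length w) = k)"

lemma lookup_homog:
  "Poly_Mapping.lookup (homog k p) w = (Poly_Mapping.lookup p w when int (length w) = k)"
  by (simp add: homog_def lookup_mapp when_def not_in_keys_iff_lookup_eq_zero)

lemma homog_zero [simp]: "homog k 0 = 0"
  by (rule poly_mapping_eqI) (simp add: lookup_homog)

lemma homog_add: "homog k (p + q) = homog k p + homog k q"
  for p :: "_ \<Rightarrow>\<^sub>0 'c::monoid_add"
  by (rule poly_mapping_eqI) (simp add: lookup_homog lookup_add when_def)

lemma homog_uminus: "homog k (- p) = - homog k p"
  for p :: "_ \<Rightarrow>\<^sub>0 'c::ab_group_add"
  by (rule poly_mapping_eqI) (simp add: lookup_homog when_def)

lemma homog_diff: "homog k (p - q) = homog k p - homog k q"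
  for p :: "_ \<Rightarrow>\<^sub>0 'c::ab_group_add"
  by (rule poly_mapping_eqI) (simp add: lookup_homog lookup_minus when_def)

lemma homog_sum: "homog k (\<Sum>i\<in>A. f i) = (\<Sum>i\<in>A. homog k (f i))"
  for f :: "_ \<Rightarrow> _ \<Rightarrow>\<^sub>0 'c::comm_monoid_add"
  by (induction A rule: infinite_finite_induct) (simp_all add: homog_add)

lemma homog_single:
  "homog k (Poly_Mapping.single w c) = (if int (length w) = k then Poly_Mapping.single w c else 0)"
  by (rule poly_mapping_eqI) (auto simp: lookup_homog lookup_single when_def)

lemma keys_homog: "Poly_Mapping.keys (homog k p) = {w \<in> Poly_Mapping.keys p. int (length w) = k}"
  by (auto simp: in_keys_iff lookup_homog when_def split: if_splits)

text \<open>Degrees are integers, so when \<open>u\<close> is longer than \<open>k\<close> the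
  shifted degree is negative and both sides vanish without a separate case.\<close>

lemma homog_single_mult:
  fixes p :: "'b list \<Rightarrow>\<^sub>0 'f::semiring_0"
  shows "homog k (Poly_Mapping.single u c * p) =
      Poly_Mapping.single u c * homog (k - int (length u)) p"
    and "homog k (p * Poly_Mapping.single u c) =
      homog (k - int (length u)) p * Poly_Mapping.single u c"
  by (induction p rule: poly_mapping_single_induct)
    (auto simp: homog_add distrib_left distrib_right mult_single homog_single plus_list_def)

lemma sum_homog:
  fixes p :: "'b list \<Rightarrow>\<^sub>0 'f::comm_monoid_add"
  assumes "finite K" "\<And>w. w \<in> Poly_Mapping.keys p \<Longrightarrow> int (length w) \<in> K"
  shows "(\<Sum>k\<in>K. homog k p) = p"
  using assms
  by (intro poly_mapping_eqI)
    (force simp: lookup_sum lookup_homog when_def in_keys_iff)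

section \<open>Envelopes with homogeneous relators\<close>

lemma free_algebra_simps:
  "p \<in> carrier (free_algebra B) \<longleftrightarrow> (\<forall>w\<in>Poly_Mapping.keys p. set w \<subseteq> B)"
  "mult (free_algebra B) = (*)" "one (free_algebra B) = 1"
  "zero (free_algebra B) = 0" "add (free_algebra B) = (+)"
  "smult (free_algebra B) = (\<lambda>c p. Poly_Mapping.single 0 c * p)"
  by (simp_all add: free_algebra_def)

lemma free_algebra_closed:
  fixes p q :: "'b list \<Rightarrow>\<^sub>0 'f::field"
  shows "0 \<in> carrier (free_algebra B :: ('f, _) module)"
    and "1 \<in> carrier (free_algebra B :: ('f, _) module)"
    and "p \<in> carrier (free_algebra B) \<Longrightarrow> q \<in> carrier (free_algebra B) \<Longrightarrow>
      p + q \<in> carrier (free_algebra B)"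
    and "p \<in> carrier (free_algebra B) \<Longrightarrow> q \<in> carrier (free_algebra B) \<Longrightarrow>
      p - q \<in> carrier (free_algebra B)"
    and "p \<in> carrier (free_algebra B) \<Longrightarrow> - p \<in> carrier (free_algebra B)"
    and "p \<in> carrier (free_algebra B) \<Longrightarrow> q \<in> carrier (free_algebra B) \<Longrightarrow>
      p * q \<in> carrier (free_algebra B)"
    and "set w \<subseteq> B \<Longrightarrow> Poly_Mapping.single w c \<in> carrier (free_algebra B :: ('f, _) module)"
    and "Poly_Mapping.single 0 c \<in> carrier (free_algebra B :: ('f, _) module)"
    and "p \<in> carrier (free_algebra B) \<Longrightarrow> homog k p \<in> carrier (free_algebra B)"
proof -
  assume pq: "p \<in> carrier (free_algebra B)" "q \<in> carrier (free_algebra B)"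
  then show "p + q \<in> carrier (free_algebra B)"
    using keys_add[of p q] unfolding free_algebra_simps(1) by blast
  show "p - q \<in> carrier (free_algebra B)"
    using pq keys_diff[of p q] unfolding free_algebra_simps(1) by blast
  show "p * q \<in> carrier (free_algebra B)"
    unfolding free_algebra_simps(1)
  proof
    fix w assume "w \<in> Poly_Mapping.keys (p * q)"
    then obtain u v where "w = u @ v" "u \<in> Poly_Mapping.keys p" "v \<in> Poly_Mapping.keys q"
      using keys_mult[of p q] by (auto simp: plus_list_def)
    then show "set w \<subseteq> B" using pq by (auto simp: free_algebra_simps(1))
  qed
qed (auto simp: free_algebra_simps(1) zero_list_def keys_homog split: if_splits)

text \<open>As fixed points of a projection, homogeneous polynomials inherit closure under linear
  operations from the linearity of \<open>homog\<close>.\<close>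

lemma free_homogeneous_iff:
  "p \<in> free_homogeneous B k \<longleftrightarrow> p \<in> carrier (free_algebra B) \<and> homog k p = p"
proof -
  have "homog k p = p \<longleftrightarrow> (\<forall>w\<in>Poly_Mapping.keys p. int (length w) = k)"
    by (auto simp: poly_mapping_eq_iff fun_eq_iff lookup_homog when_def in_keys_iff)
  then show ?thesis by (simp add: free_homogeneous_def)
qed

lemma homog_homog: "homog j (homog k p) = (if j = k then homog k p else 0)"
  by (rule poly_mapping_eqI) (simp add: lookup_homog when_def)

lemma homog_in_free_homogeneous:
  "p \<in> carrier (free_algebra B) \<Longrightarrow> homog k p \<in> free_homogeneous B k"
  by (simp add: free_homogeneous_iff free_algebra_closed homog_homog)

lemma homog_if_free_homogeneous:
  "p \<in> free_homogeneous B k \<Longrightarrow> homog j p = (if j = k then p else 0)"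
  by (metis free_homogeneous_iff homog_homog)

lemma free_homogeneous_closed:
  fixes p q :: "'b list \<Rightarrow>\<^sub>0 'f::field"
  shows "0 \<in> (free_homogeneous B k :: ('b list \<Rightarrow>\<^sub>0 'f) set)"
    and "1 \<in> (free_homogeneous B 0 :: ('b list \<Rightarrow>\<^sub>0 'f) set)"
    and "p \<in> free_homogeneous B k \<Longrightarrow> q \<in> free_homogeneous B k \<Longrightarrow>
      p + q \<in> free_homogeneous B k"
    and "p \<in> free_homogeneous B k \<Longrightarrow> - p \<in> free_homogeneous B k"
    and "p \<in> free_homogeneous B k \<Longrightarrow> Poly_Mapping.single 0 c * p \<in> free_homogeneous B k"
    and "p \<in> free_homogeneous B i \<Longrightarrow> q \<in> free_homogeneous B j \<Longrightarrow>
      p * q \<in> free_homogeneous B (i + j)"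
proof -
  show "p * q \<in> free_homogeneous B (i + j)"
    if "p \<in> free_homogeneous B i" "q \<in> free_homogeneous B j"
    using that keys_mult[of p q]
    by (fastforce simp: free_homogeneous_def free_algebra_closed plus_list_def)
qed (simp_all add: free_homogeneous_iff free_algebra_closed homog_add homog_uminus
    homog_single_mult zero_list_def homog_single flip: single_one)

lemma ring_free_algebra: "ring (free_algebra B :: ('f::field, 'b list \<Rightarrow>\<^sub>0 'f) module)"
proof (intro ringI abelian_groupI monoidI)
  fix p assume "p \<in> carrier (free_algebra B :: ('f, 'b list \<Rightarrow>\<^sub>0 'f) module)"
  then show "\<exists>q\<in>carrier (free_algebra B). q \<oplus>\<^bsub>free_algebra B\<^esub> p = \<zero>\<^bsub>free_algebra B\<^esub>"
    by (intro bexI[of _ "- p"]) (simp_all add: free_algebra_simps(2-) free_algebra_closed(5))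
qed (simp_all add: free_algebra_simps(2-) free_algebra_closed algebra_simps)

lemma a_inv_free_algebra:
  fixes p :: "'b list \<Rightarrow>\<^sub>0 'f::field"
  assumes "p \<in> carrier (free_algebra B)"
  shows "\<ominus>\<^bsub>free_algebra B\<^esub> p = - p"
proof -
  interpret ring "free_algebra B :: ('f, 'b list \<Rightarrow>\<^sub>0 'f) module" by (rule ring_free_algebra)
  show ?thesis
    using assms by (intro minus_equality) (auto simp: free_algebra_simps(2-) free_algebra_closed)
qed

text \<open>Negatives are products with \<open>- 1\<close>, an element of the free algebra, so
  closure under sums and products suffices.\<close>

lemma ideal_free_algebraI:
  fixes I :: "('b list \<Rightarrow>\<^sub>0 'f::field) set"
  assumes "I \<subseteq> carrier (free_algebra B)" "0 \<in> I"
    and "\<And>p q. p \<in> I \<Longrightarrow> q \<in> I \<Longrightarrow> p + q \<in> I"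
    and "\<And>p q. p \<in> I \<Longrightarrow> q \<in> carrier (free_algebra B) \<Longrightarrow> p * q \<in> I \<and> q * p \<in> I"
  shows "ideal I (free_algebra B)"
proof (rule idealI[OF ring_free_algebra])
  interpret ring "free_algebra B :: ('f, 'b list \<Rightarrow>\<^sub>0 'f) module" by (rule ring_free_algebra)
  have "- p \<in> I" if "p \<in> I" for p
    using assms(4)[OF that, of "- 1"] by (simp add: free_algebra_closed)
  then show "subgroup I (add_monoid (free_algebra B))"
    using assms(1-3)
    by (intro add.subgroupI)
      (auto simp: free_algebra_simps(2-) a_inv_def[symmetric] subset_iff a_inv_free_algebra)
qed (use assms in \<open>auto simp: free_algebra_simps(2-)\<close>)

text \<open>Each relator is homogeneous, possibly in a degree of its own. This makes the generated
  ideal graded, from which the grading of the quotient follows.\<close>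

locale homogeneous_envelope =
  fixes J :: "('f::field, 'f mat) module" and B :: "'f mat set"
  assumes relators: "envelope_relators J B \<subseteq> (\<Union>k. free_homogeneous B k)"
begin

abbreviation "R \<equiv> free_algebra B :: ('f, 'f mat list \<Rightarrow>\<^sub>0 'f) module"
abbreviation "I \<equiv> envelope_ideal J B"
abbreviation "cls \<equiv> envelope_class J B"
abbreviation "U \<equiv> universal_envelope J B"

sublocale R: ring R by (rule ring_free_algebra)

lemma relators_carrier: "envelope_relators J B \<subseteq> carrier R"
  using relators by (auto simp: free_homogeneous_iff)

sublocale ideal I R
  unfolding envelope_ideal_def by (rule R.genideal_ideal[OF relators_carrier])

lemma relators_ideal: "envelope_relators J B \<subseteq> I"
  unfolding envelope_ideal_def by (rule R.genideal_self[OF relators_carrier])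

lemma ideal_closed:
  "0 \<in> I" "p \<in> I \<Longrightarrow> q \<in> I \<Longrightarrow> p + q \<in> I"
  "p \<in> I \<Longrightarrow> q \<in> carrier R \<Longrightarrow> p * q \<in> I"
  "p \<in> I \<Longrightarrow> q \<in> carrier R \<Longrightarrow> q * p \<in> I"
  using zero_closed a_closed[of p q] I_r_closed[of p q] I_l_closed[of p q]
  by (simp_all add: free_algebra_simps(2-))

lemma ideal_minimal:
  assumes "ideal I' R" "envelope_relators J B \<subseteq> I'"
  shows "I \<subseteq> I'"
  unfolding envelope_ideal_def by (rule R.genideal_minimal[OF assms])

text \<open>The polynomials all of whose homogeneous parts lie in \<open>I\<close> form an ideal
  containing the relators; by minimality it contains \<open>I\<close>.\<close>

lemma ideal_homog:
  assumes "p \<in> I" shows "homog k p \<in> I"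
proof -
  let ?I = "{p \<in> carrier R. \<forall>k. homog k p \<in> I}"
  have "ideal ?I R"
  proof (rule ideal_free_algebraI)
    fix p q assume p: "p \<in> ?I" and q: "q \<in> carrier R"
    have "homog k (p * q) \<in> I \<and> homog k (q * p) \<in> I" for k
    \<comment> \<open>By additivity \<open>q\<close> may be taken to be a single term, and
      multiplication by it only shifts degrees.\<close>
    proof (induction q rule: poly_mapping_single_induct)
      case (single w c)
      then have "Poly_Mapping.single w c \<in> carrier R"
        using q by (simp add: free_algebra_simps(1) free_algebra_closed(7))
      then show ?case using p by (simp add: homog_single_mult ideal_closed)
    qed (simp_all add: ideal_closed distrib_left distrib_right homog_add)
    then show "p * q \<in> ?I \<and> q * p \<in> ?I" using p q by (simp add: free_algebra_closed)
  qed (auto simp: free_algebra_closed ideal_closed homog_add)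
  moreover have "envelope_relators J B \<subseteq> ?I"
  proof
    fix r assume r: "r \<in> envelope_relators J B"
    then obtain j where "r \<in> free_homogeneous B j" using relators by blast
    then show "r \<in> ?I"
      using r relators_ideal relators_carrier
      by (auto simp: homog_if_free_homogeneous ideal_closed)
  qed
  ultimately show ?thesis using ideal_minimal assms by blast
qed

lemma cls_eq_iff:
  assumes "p \<in> carrier R" "q \<in> carrier R"
  shows "cls p = cls q \<longleftrightarrow> p - q \<in> I"
  using R.quotient_eq_iff_same_a_r_cos[OF is_ideal assms] assms
  by (simp add: envelope_class_def a_minus_def a_inv_free_algebra free_algebra_simps(2-))

lemma mem_cls: "p \<in> carrier R \<Longrightarrow> p \<in> cls p"
  unfolding envelope_class_def by (rule a_rcos_self)

lemma cls_memD:
  assumes "q \<in> cls p" "p \<in> carrier R"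
  shows "q \<in> carrier R" "cls q = cls p"
  using assms a_repr_independence'[of q p] a_elemrcos_carrier[of p q]
  by (simp_all add: envelope_class_def)

section \<open>The algebra structure of the quotient on representatives\<close>

lemma universal_envelope_simps:
  "carrier U = carrier (R Quot I)" "zero U = zero (R Quot I)" "one U = one (R Quot I)"
  "add U = add (R Quot I)" "mult U = mult (R Quot I)"
  "smult U = (\<lambda>c X. \<Union>p\<in>X. cls (c \<odot>\<^bsub>R\<^esub> p))"
  by (simp_all add: universal_envelope_def ring.defs module.defs)

lemma carrier_U: "carrier U = cls ` carrier R"
  unfolding universal_envelope_simps FactRing_def A_RCOSETS_def' envelope_class_def
  by (simp add: UNION_singleton_eq_range)

lemma zero_U: "\<zero>\<^bsub>U\<^esub> = cls 0"
  using R.a_coset_join2[OF R.zero_closed a_subgroup zero_closed]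
  by (simp add: universal_envelope_simps FactRing_def envelope_class_def free_algebra_simps(4))

lemma one_U: "\<one>\<^bsub>U\<^esub> = cls 1"
  by (simp add: universal_envelope_simps FactRing_def envelope_class_def free_algebra_simps(3))

lemma add_U: "p \<in> carrier R \<Longrightarrow> q \<in> carrier R \<Longrightarrow> cls p \<oplus>\<^bsub>U\<^esub> cls q = cls (p + q)"
  using a_rcos_sum[of p q]
  by (simp add: universal_envelope_simps FactRing_def envelope_class_def free_algebra_simps(5))

lemma mult_U: "p \<in> carrier R \<Longrightarrow> q \<in> carrier R \<Longrightarrow> cls p \<otimes>\<^bsub>U\<^esub> cls q = cls (p * q)"
  using rcoset_mult_add[of p q]
  by (simp add: universal_envelope_simps FactRing_def envelope_class_def free_algebra_simps(2))

text \<open>The scalar multiple is a union over all representatives. It collapses to one class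
  because \<open>I\<close> absorbs multiplication by constants.\<close>

lemma smult_U:
  assumes p: "p \<in> carrier R"
  shows "c \<odot>\<^bsub>U\<^esub> cls p = cls (Poly_Mapping.single 0 c * p)"
proof -
  have "cls (Poly_Mapping.single 0 c * q) = cls (Poly_Mapping.single 0 c * p)" if "q \<in> cls p" for q
  proof -
    have "q \<in> carrier R" "q - p \<in> I" using cls_memD[OF that p] cls_eq_iff p by auto
    then show ?thesis
      using p by (subst cls_eq_iff)
        (simp_all add: free_algebra_closed ideal_closed flip: right_diff_distrib)
  qed
  then have "(\<Union>q\<in>cls p. cls (Poly_Mapping.single 0 c * q)) =
      (\<Union>q\<in>cls p. cls (Poly_Mapping.single 0 c * p))"
    by (rule SUP_cong[OF refl])
  also have "\<dots> = cls (Poly_Mapping.single 0 c * p)"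
    using mem_cls[OF p] by blast
  finally show ?thesis by (simp add: universal_envelope_simps free_algebra_simps(6))
qed

lemmas U_simps = zero_U one_U add_U mult_U smult_U

lemma ring_U: "ring U"
proof (intro ringI abelian_groupI monoidI)
  fix x assume "x \<in> carrier U"
  then obtain p where p: "p \<in> carrier R" "x = cls p" by (auto simp: carrier_U)
  then show "\<exists>y\<in>carrier U. y \<oplus>\<^bsub>U\<^esub> x = \<zero>\<^bsub>U\<^esub>"
    by (intro bexI[of _ "cls (- p)"]) (simp_all add: U_simps carrier_U free_algebra_closed)
qed (auto simp: carrier_U U_simps free_algebra_closed algebra_simps)

sublocale U_ring: ring U by (rule ring_U)

lemma vectorspace_U: "vectorspace class_ring U"
  unfolding vectorspace_def
proof (intro conjI moduleI)
  show "cring (class_ring :: 'f ring)" "field (class_ring :: 'f ring)"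
    using class_field by (auto simp: field_def domain_def)
  show "abelian_group U" by (rule U_ring.is_abelian_group)
qed (auto simp: carrier_U U_simps free_algebra_closed algebra_simps single_add mult_single
    mult.assoc[symmetric])

sublocale U: vectorspace class_ring U by (rule vectorspace_U)

lemma assoc_algebra_U: "assoc_algebra class_ring U"
proof -
  \<comment> \<open>Constants are central in the free algebra, so the scalar may be moved past
    \<open>p\<close>.\<close>
  have "cls (Poly_Mapping.single 0 c * (p * q)) = cls (p * (Poly_Mapping.single 0 c * q))" for c p q
    by (metis mult.assoc single_0_mult_commute)
  then show ?thesis
    unfolding assoc_algebra_def using ring_U vectorspace_U
    by (auto simp: carrier_U U_simps free_algebra_closed mult.assoc)
qed

section \<open>The grading of the quotient\<close>

lemma free_homogeneous_carrier: "p \<in> free_homogeneous B k \<Longrightarrow> p \<in> carrier R"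
  by (simp add: free_homogeneous_def)

lemma subspace_component: "subspace class_ring (envelope_component J B k) U"
proof -
  have "submodule class_ring (envelope_component J B k) U"
    unfolding submodule_def using U.module_axioms
    by (auto simp: envelope_component_def U_simps carrier_U free_homogeneous_carrier
        free_homogeneous_closed)
  then show ?thesis unfolding subspace_def using vectorspace_U by blast
qed

lemma finsum_cls:
  assumes "finite K" "\<And>k. k \<in> K \<Longrightarrow> f k \<in> carrier R"
  shows "(\<Oplus>\<^bsub>U\<^esub>k\<in>K. cls (f k)) = cls (\<Sum>k\<in>K. f k)"
    and "(\<Sum>k\<in>K. f k) \<in> carrier R"
proof -
  \<comment> \<open>Both claims go through one induction, since \<open>add_U\<close> needs the
    partial sum to lie in the free algebra.\<close>
  have "(\<Oplus>\<^bsub>U\<^esub>k\<in>K. cls (f k)) = cls (\<Sum>k\<in>K. f k) \<and> (\<Sum>k\<in>K. f k) \<in> carrier R"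
    using assms
  proof (induction K)
    case (insert k K)
    then show ?case
      by (subst U_ring.finsum_insert) (auto simp: carrier_U add_U free_algebra_closed)
  qed (simp add: zero_U free_algebra_closed)
  then show "(\<Oplus>\<^bsub>U\<^esub>k\<in>K. cls (f k)) = cls (\<Sum>k\<in>K. f k)"
    and "(\<Sum>k\<in>K. f k) \<in> carrier R" by blast+
qed

text \<open>Existence: the classes of the homogeneous parts of a representative. Uniqueness: two
  representatives differ by an element of \<open>I\<close>, whose homogeneous parts again lie in
  \<open>I\<close>, so the classes agree degree by degree.\<close>

lemma unique_decomposition:
  assumes "x \<in> carrier U"
  shows "\<exists>!c. (\<forall>k. c k \<in> envelope_component J B k) \<and> finite {k. c k \<noteq> \<zero>\<^bsub>U\<^esub>} \<and>
    x = (\<Oplus>\<^bsub>U\<^esub>k\<in>{k. c k \<noteq> \<zero>\<^bsub>U\<^esub>}. c k)"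
proof -
  obtain p where p: "p \<in> carrier R" and x: "x = cls p"
    using assms by (auto simp: carrier_U)
  define d where "d k = cls (homog k p)" for k
  have d: "d k \<in> envelope_component J B k" for k
    using p by (auto simp: d_def envelope_component_def homog_in_free_homogeneous)
  \<comment> \<open>These are the degrees that occur in \<open>p\<close>. The set may exceed the
    support of \<open>d\<close>, as a nonzero part of \<open>p\<close> may lie in \<open>I\<close>;
    the extra summands are zero classes.\<close>
  let ?K = "(\<lambda>w. int (length w)) ` Poly_Mapping.keys p"
  have supp: "{k. d k \<noteq> \<zero>\<^bsub>U\<^esub>} \<subseteq> ?K"
  proof
    fix k assume "k \<in> {k. d k \<noteq> \<zero>\<^bsub>U\<^esub>}"
    then have "homog k p \<noteq> 0" by (auto simp: d_def zero_U)
    then show "k \<in> ?K" using keys_homog[of k p] by (force simp flip: keys_eq_empty)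
  qed
  have "x = cls (\<Sum>k\<in>?K. homog k p)"
    by (subst sum_homog) (simp_all add: x)
  also have "\<dots> = (\<Oplus>\<^bsub>U\<^esub>k\<in>?K. d k)"
    unfolding d_def using p by (subst finsum_cls) (simp_all add: free_algebra_closed)
  also have "\<dots> = (\<Oplus>\<^bsub>U\<^esub>k\<in>{k. d k \<noteq> \<zero>\<^bsub>U\<^esub>}. d k)"
  proof (rule U_ring.add.finprod_mono_neutral_cong_right)
    show "d \<in> ?K \<rightarrow> carrier U"
      using p by (auto simp: d_def carrier_U free_algebra_closed)
  qed (use supp in auto)
  finally have sum_d: "x = (\<Oplus>\<^bsub>U\<^esub>k\<in>{k. d k \<noteq> \<zero>\<^bsub>U\<^esub>}. d k)" .
  show ?thesis
  proof (rule ex1I[of _ d])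
    have "finite {k. d k \<noteq> \<zero>\<^bsub>U\<^esub>}" by (rule finite_subset[OF supp]) simp
    with d sum_d show "(\<forall>k. d k \<in> envelope_component J B k) \<and> finite {k. d k \<noteq> \<zero>\<^bsub>U\<^esub>} \<and>
      x = (\<Oplus>\<^bsub>U\<^esub>k\<in>{k. d k \<noteq> \<zero>\<^bsub>U\<^esub>}. d k)" by blast
  next
    fix c assume c: "(\<forall>k. c k \<in> envelope_component J B k) \<and> finite {k. c k \<noteq> \<zero>\<^bsub>U\<^esub>} \<and>
      x = (\<Oplus>\<^bsub>U\<^esub>k\<in>{k. c k \<noteq> \<zero>\<^bsub>U\<^esub>}. c k)"
    let ?S = "{k. c k \<noteq> \<zero>\<^bsub>U\<^esub>}"
    have "\<exists>q. q \<in> free_homogeneous B k \<and> c k = cls q" for k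
      using c unfolding envelope_component_def by blast
    then obtain q where q: "q k \<in> free_homogeneous B k" and cq: "c k = cls (q k)" for k
      by metis
    have q_carrier: "q k \<in> carrier R" for k by (rule free_homogeneous_carrier[OF q])
    have fin: "finite ?S" using c by simp
    have "cls p = (\<Oplus>\<^bsub>U\<^esub>k\<in>?S. c k)" using c x by simp
    also have "\<dots> = cls (\<Sum>k\<in>?S. q k)"
      unfolding cq by (rule finsum_cls(1)) (use fin q_carrier cq in simp_all)
    finally have I: "p - (\<Sum>k\<in>?S. q k) \<in> I"
      using cls_eq_iff[OF p finsum_cls(2)[of ?S q, OF fin q_carrier]] by blast
    show "c = d"
    proof
      fix j
      \<comment> \<open>Outside \<open>?S\<close> the class \<open>c j\<close> is zero although
        \<open>q j\<close> may be a nonzero element of \<open>I\<close>. The sum has no term of that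
        degree, so the representative there is 0.\<close>
      let ?q = "if j \<in> ?S then q j else 0"
      have "homog j (\<Sum>k\<in>?S. q k) = (\<Sum>k\<in>?S. if j = k then q k else 0)"
        by (simp only: homog_sum homog_if_free_homogeneous[OF q])
      also have "\<dots> = ?q"
        by (rule sum.delta'[OF fin])
      finally have "homog j p - ?q \<in> I"
        using ideal_homog[OF I, of j] by (simp only: homog_diff)
      moreover have "?q \<in> carrier R"
        by (simp only: q_carrier free_algebra_closed(1) split: if_split) blast
      ultimately have "d j = cls ?q"
        unfolding d_def using cls_eq_iff[OF free_algebra_closed(9)[OF p]] by blast
      also have "\<dots> = c j"
        by (cases "j \<in> ?S") (simp_all only: cq[symmetric] zero_U[symmetric] if_True if_False,
          simp)
      finally show "c j = d j" ..
    qed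
  qed
qed

lemma Z_graded_algebra_U: "Z_graded_algebra class_ring U (envelope_component J B)"
  unfolding Z_graded_algebra_def
proof (intro conjI allI ballI assoc_algebra_U subspace_component unique_decomposition)
  show "\<one>\<^bsub>U\<^esub> \<in> envelope_component J B 0"
    by (auto simp: one_U envelope_component_def free_homogeneous_closed)
  fix i j x y assume "x \<in> envelope_component J B i" "y \<in> envelope_component J B j"
  then show "x \<otimes>\<^bsub>U\<^esub> y \<in> envelope_component J B (i + j)"
    by (auto simp: envelope_component_def mult_U free_homogeneous_carrier free_homogeneous_closed)
qed

end

section \<open>Commutative images of words\<close>

text \<open>The Parikh vector of a word, read as the exponent function of its commutative
  image.\<close>

definition content :: "'b list \<Rightarrow> 'b \<Rightarrow>\<^sub>0 nat" where
  "content w = (\<Sum>x\<leftarrow>w. Poly_Mapping.single x 1)"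

lemma content_zero: "content 0 = 0"
  by (simp add: content_def zero_list_def)

lemma content_plus: "content (u + v) = content u + content v"
  by (simp add: content_def plus_list_def)

lemma content_rev: "content (rev w) = content w"
  by (simp add: content_def flip: rev_map)

lemma lookup_content: "Poly_Mapping.lookup (content w) x = count_list w x"
  by (induction w) (auto simp: content_def lookup_add lookup_single when_def)

lemma count_list_replicate: "count_list (replicate n y) x = (if x = y then n else 0)"
  by (induction n) auto

lemma keys_content: "Poly_Mapping.keys (content w) = set w"
  by (auto simp: in_keys_iff lookup_content count_list_0_iff)

lemma degree_content:
  "(\<Sum>x\<in>Poly_Mapping.keys (content w). Poly_Mapping.lookup (content w) x) = length w"
  by (simp add: keys_content lookup_content sum_count_set)

lemma poly_homogeneous_iff:
  "p \<in> poly_homogeneous B k \<longleftrightarrow> (\<forall>m\<in>Poly_Mapping.keys p. Poly_Mapping.keys m \<subseteq> B \<and>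
     int (\<Sum>x\<in>Poly_Mapping.keys m. Poly_Mapping.lookup m x) = k)"
  by (auto simp: poly_homogeneous_def poly_algebra_def)

lemma vectorspace_poly_homogeneous:
  "vectorspace class_ring ((poly_algebra B)\<lparr>carrier := poly_homogeneous B k\<rparr> ::
     ('f::field, ('b \<Rightarrow>\<^sub>0 nat) \<Rightarrow>\<^sub>0 'f) module)"
proof -
  let ?C = "poly_homogeneous B k :: (('b \<Rightarrow>\<^sub>0 nat) \<Rightarrow>\<^sub>0 'f) set"
  have "vectorspace class_ring \<lparr>carrier = ?C, mult = (*), one = 1, zero = 0, add = (+),
    smult = (\<lambda>c p. Poly_Mapping.single 0 c * p)\<rparr>"
  proof (rule vectorspace_convolution)
    fix p q :: "('b \<Rightarrow>\<^sub>0 nat) \<Rightarrow>\<^sub>0 'f" and c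
    assume p: "p \<in> ?C"
    show "Poly_Mapping.single 0 c * p \<in> ?C"
      using p by (auto simp: poly_homogeneous_iff in_keys_iff lookup_single_0_mult)
    assume q: "q \<in> ?C"
    show "p + q \<in> ?C"
      using p q keys_add[of p q] unfolding poly_homogeneous_iff by blast
  qed (simp add: poly_homogeneous_iff)
  then show ?thesis by (simp add: poly_algebra_def)
qed

lemma push_content_homogeneous:
  assumes "p \<in> free_homogeneous B k"
  shows "push content p \<in> poly_homogeneous B k"
proof -
  have "Poly_Mapping.keys m \<subseteq> B \<and>
      int (\<Sum>x\<in>Poly_Mapping.keys m. Poly_Mapping.lookup m x) = k"
    if m: "m \<in> Poly_Mapping.keys (push content p)" for m
  proof -
    obtain w where "w \<in> Poly_Mapping.keys p" "m = content w"
      using keys_push[of content p] m by blast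
    then show ?thesis
      using assms degree_content[of w]
      by (simp add: free_homogeneous_def free_algebra_simps(1) keys_content)
  qed
  then show ?thesis unfolding poly_homogeneous_iff by blast
qed

section \<open>The envelope of a two-dimensional system with vanishing anti-tetrad\<close>

text \<open>Vanishing anti-tetrads reduce the relators to differences of a word of length four and
  its reversal. The assumptions record just this, so that \<open>a\<close> and \<open>b\<close> act
  from here on as two distinct letters.\<close>

locale reversal_envelope =
  fixes J :: "('f::field, 'f mat) module" and a b :: "'f mat"
  assumes neq: "a \<noteq> b"
    and relators_eq: "envelope_relators J {a, b} =
      {Poly_Mapping.single [w, x, y, z] 1 - Poly_Mapping.single [z, y, x, w] 1 | w x y z.
        {w, x, y, z} \<subseteq> {a, b}}"
begin

sublocale homogeneous_envelope J "{a, b}"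
proof
  show "envelope_relators J {a, b} \<subseteq> (\<Union>k. free_homogeneous {a, b} k)"
    unfolding relators_eq
    by (auto simp: free_homogeneous_iff homog_diff homog_single
        intro!: exI[of _ 4] free_algebra_closed)
qed

section \<open>From equivalence of words to congruence modulo the ideal\<close>

text \<open>The difference is a relator multiplied on the left by the common prefix, which carries
  the coefficient \<open>c\<close>, and on the right by the common suffix. Equality of the letter
  sets lets the claim be iterated along chains of steps.\<close>

lemma reversal_step_ideal:
  assumes "reversal_step u v" "set u \<subseteq> {a, b}"
  shows "set v = set u" "Poly_Mapping.single u c - Poly_Mapping.single v c \<in> I"
proof -
  obtain p w x y z q where u: "u = p @ [w, x, y, z] @ q" and v: "v = p @ [z, y, x, w] @ q"
    using assms(1) unfolding reversal_step_def by blast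
  show "set v = set u" using u v by auto
  let ?r = "Poly_Mapping.single [w, x, y, z] 1 - Poly_Mapping.single [z, y, x, w] 1"
  have "{w, x, y, z} \<subseteq> {a, b}" using assms(2) u by simp
  then have "?r \<in> envelope_relators J {a, b}" unfolding relators_eq by blast
  then have "?r \<in> I" using relators_ideal by blast
  then have "Poly_Mapping.single p c * ?r * Poly_Mapping.single q 1 \<in> I"
    using assms(2) u by (intro ideal_closed free_algebra_closed) auto
  then show "Poly_Mapping.single u c - Poly_Mapping.single v c \<in> I"
    by (simp add: u v left_diff_distrib right_diff_distrib mult_single plus_list_def)
qed

lemma reversal_equiv_ideal:
  assumes "reversal_equiv u v" "set u \<subseteq> {a, b}"
  shows "Poly_Mapping.single u c - Poly_Mapping.single v c \<in> I"
proof -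
  have "set v = set u \<and> Poly_Mapping.single u c - Poly_Mapping.single v c \<in> I"
    using assms(1)
  proof induction
    case (step v v')
    then have "set v' = set v" and "Poly_Mapping.single v c - Poly_Mapping.single v' c \<in> I"
      using reversal_step_ideal(1)[of v v'] reversal_step_ideal(2)[of v v' c] assms(2) by auto
    then show ?case
      using step ideal_closed(2)[of "Poly_Mapping.single u c - Poly_Mapping.single v c"
          "Poly_Mapping.single v c - Poly_Mapping.single v' c"] by simp
  qed (simp add: ideal_closed)
  then show ?thesis ..
qed

section \<open>Abelianization of the envelope\<close>

text \<open>The kernel of abelianization is an ideal, and it contains the relators because a word
  and its reversal have the same content. Minimality of \<open>I\<close> does the rest.\<close>

lemma push_content_ideal:
  assumes "p \<in> I" shows "push content p = 0"
proof -
  let ?K = "{p \<in> carrier R. push content p = 0}"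
  have "ideal ?K R"
    by (rule ideal_free_algebraI)
      (auto simp: free_algebra_closed push_add push_mult[OF content_plus])
  moreover have "envelope_relators J {a, b} \<subseteq> ?K"
  proof
    fix r assume r: "r \<in> envelope_relators J {a, b}"
    then obtain w x y z
      where "r = Poly_Mapping.single [w, x, y, z] 1 - Poly_Mapping.single [z, y, x, w] 1"
      unfolding relators_eq by blast
    then show "r \<in> ?K"
      using content_rev[of "[w, x, y, z]"] r relators_carrier by (auto simp: push_diff)
  qed
  ultimately show ?thesis using ideal_minimal assms by blast
qed

text \<open>The induced map on classes, evaluated at an arbitrary representative. By
  \<open>push_content_ideal\<close> the value on a class is independent of this choice.\<close>

definition abelianize :: "('f mat list \<Rightarrow>\<^sub>0 'f) set \<Rightarrow> ('f mat \<Rightarrow>\<^sub>0 nat) \<Rightarrow>\<^sub>0 'f" where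
  "abelianize X = push content (SOME p. p \<in> X)"

lemma abelianize_cls:
  assumes "p \<in> carrier R"
  shows "abelianize (cls p) = push content p"
proof -
  define q where "q = (SOME q. q \<in> cls p)"
  have "q \<in> cls p" unfolding q_def using mem_cls[OF assms] by (rule someI)
  then have "q \<in> carrier R" "cls q = cls p" using cls_memD assms by blast+
  then have "q - p \<in> I" using cls_eq_iff assms by blast
  then show ?thesis
    using push_content_ideal[of "q - p"] by (simp add: abelianize_def q_def push_diff)
qed

lemma abelianize_zero: "abelianize \<zero>\<^bsub>U\<^esub> = 0"
  by (simp add: zero_U abelianize_cls free_algebra_closed)

lemma abelianize_add:
  "X \<in> carrier U \<Longrightarrow> Y \<in> carrier U \<Longrightarrow> abelianize (X \<oplus>\<^bsub>U\<^esub> Y) = abelianize X + abelianize Y"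
  by (auto simp: carrier_U add_U abelianize_cls free_algebra_closed push_add)

lemma abelianize_smult:
  "X \<in> carrier U \<Longrightarrow> abelianize (c \<odot>\<^bsub>U\<^esub> X) = Poly_Mapping.single 0 c * abelianize X"
  by (auto simp: carrier_U smult_U abelianize_cls free_algebra_closed
      push_mult[OF content_plus] content_zero)

text \<open>The coefficient of one fixed monomial in the abelianization is a linear functional on
  the envelope; such functionals detect linear independence.\<close>

lemma lookup_abelianize_lincomb:
  assumes "finite A" "A \<subseteq> carrier U"
  shows "Poly_Mapping.lookup (abelianize (U.lincomb c A)) k =
    (\<Sum>X\<in>A. c X * Poly_Mapping.lookup (abelianize X) k)"
  using assms
proof (induction A)
  case (insert X A)
  then have "U.lincomb c (insert X A) = c X \<odot>\<^bsub>U\<^esub> X \<oplus>\<^bsub>U\<^esub> U.lincomb c A"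
    unfolding U.lincomb_def by (subst U_ring.finsum_insert) auto
  then show ?case
    using insert
    by (simp add: abelianize_add abelianize_smult U.lincomb_closed lookup_add lookup_single_0_mult)
qed (simp add: U.lincomb_def abelianize_zero)

section \<open>Infinite dimension\<close>

lemma not_fin_dim_U: "\<not> U.fin_dim"
proof
  assume fin: U.fin_dim
  define e where "e n = cls (Poly_Mapping.single (replicate n a) 1)" for n
  define m where "m n = Poly_Mapping.single a n" for n :: nat
  have "content (replicate n a) = m n" for n
    by (rule poly_mapping_eqI) (simp add: m_def lookup_content lookup_single when_def count_list_replicate)
  moreover have "Poly_Mapping.single (replicate n a) 1 \<in> carrier R" for n
    by (rule free_algebra_closed) auto
  ultimately have e: "e n \<in> carrier U" "abelianize (e n) = Poly_Mapping.single (m n) 1" for n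
    by (auto simp: e_def carrier_U abelianize_cls)
  have inj: "inj m" unfolding m_def by (metis injI lookup_single_eq)
  have "inj e"
  proof (rule injI)
    fix i j assume "e i = e j"
    then have "Poly_Mapping.single (m i) (1 :: 'f) = Poly_Mapping.single (m j) 1"
      using e(2) by metis
    then have "m i = m j" by (metis keys_single singleton_inject zero_neq_one)
    then show "i = j" using inj by (simp add: inj_eq)
  qed
  then have "\<not> finite (range e)" using finite_imageD by blast
  moreover have "U.lin_indpt (range e)"
  proof
    assume "U.lin_dep (range e)"
    then obtain A c X where A: "finite A" "A \<subseteq> range e" "U.lincomb c A = \<zero>\<^bsub>U\<^esub>"
      and X: "X \<in> A" "c X \<noteq> 0"
      unfolding U.lin_dep_def by auto
    then obtain n where n: "X = e n" by auto
    \<comment> \<open>Among the powers of \<open>a\<close> only \<open>e n\<close> has a nonzero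
      coefficient at the monomial \<open>m n\<close>, so this functional isolates \<open>c X\<close>
      in the supposed relation.\<close>
    have "0 = (\<Sum>Y\<in>A. c Y * Poly_Mapping.lookup (abelianize Y) (m n))"
      using lookup_abelianize_lincomb[of A c "m n"] A e(1) by (auto simp: abelianize_zero)
    also have "\<dots> = (\<Sum>Y\<in>A. if Y = X then c Y else 0)"
    proof (rule sum.cong)
      fix Y assume "Y \<in> A"
      then obtain i where "Y = e i" using A by auto
      then show "c Y * Poly_Mapping.lookup (abelianize Y) (m n) = (if Y = X then c Y else 0)"
        using \<open>inj e\<close> inj by (auto simp: e n lookup_single when_def inj_eq)
    qed simp
    also have "\<dots> = c X" using A X by simp
    finally show False using X by simp
  qed
  ultimately show False using U.fin_dim_li_fin[OF fin] e(1) by blast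
qed

section \<open>Sorted words and the components of degree at least six\<close>

text \<open>The normal form with all \<open>a\<close> before all \<open>b\<close>. On monomials in
  these two letters it is a right inverse of \<open>content\<close>.\<close>

definition sorted_word :: "('f mat \<Rightarrow>\<^sub>0 nat) \<Rightarrow> 'f mat list" where
  "sorted_word m =
    replicate (Poly_Mapping.lookup m a) a @ replicate (Poly_Mapping.lookup m b) b"

lemma content_sorted_word:
  assumes "Poly_Mapping.keys m \<subseteq> {a, b}"
  shows "content (sorted_word m) = m"
proof (rule poly_mapping_eqI)
  fix x
  show "Poly_Mapping.lookup (content (sorted_word m)) x = Poly_Mapping.lookup m x"
    using assms neq by (auto simp: lookup_content sorted_word_def in_keys_iff count_list_replicate)
qed

lemma set_sorted_word: "set (sorted_word m) \<subseteq> {a, b}"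
  by (auto simp: sorted_word_def)

lemma reversal_equiv_sorted_word:
  assumes "set w \<subseteq> {a, b}" "length w \<ge> 6"
  shows "reversal_equiv w (sorted_word (content w))"
proof (rule reversal_equiv_if_mset_eq)
  have "content (sorted_word (content w)) = content w"
    using assms by (intro content_sorted_word) (simp add: keys_content)
  then have "count_list (sorted_word (content w)) x = count_list w x" for x
    by (metis lookup_content)
  then show "mset w = mset (sorted_word (content w))"
    by (intro multiset_eqI) (simp add: count_mset)
qed (use assms in auto)

text \<open>All words of \<open>p\<close> have length at least six, so modulo \<open>I\<close> each
  may be replaced by its sorted form. The sorted polynomial is determined by
  \<open>push content p\<close> and therefore vanishes.\<close>

lemma ideal_if_push_content_eq_zero:
  assumes p: "p \<in> free_homogeneous {a, b} n" and "n \<ge> 6" and "push content p = 0"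
  shows "p \<in> I"
proof -
  have "p - push (sorted_word \<circ> content) p \<in> I"
  proof (induction p rule: poly_mapping_single_induct)
    case (add q r)
    then show ?case
      using ideal_closed(2)[OF add] by (simp add: push_add algebra_simps)
  next
    case (single w c)
    then have "set w \<subseteq> {a, b}" "length w \<ge> 6"
      using p \<open>n \<ge> 6\<close> by (auto simp: free_homogeneous_def free_algebra_simps(1))
    then show ?case
      using reversal_equiv_ideal[OF reversal_equiv_sorted_word] by simp
  qed (simp add: ideal_closed)
  then show ?thesis using assms(3) by (simp flip: push_push)
qed

text \<open>The isomorphism is \<open>abelianize\<close>. Injectivity is the vanishing criterion
  \<open>ideal_if_push_content_eq_zero\<close> applied to differences; sorting the monomials gives
  surjectivity.\<close>

lemma linearly_isomorphic_component:
  assumes "n \<ge> 6"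
  shows "linearly_isomorphic class_ring
    (U\<lparr>carrier := envelope_component J {a, b} n\<rparr>)
    ((poly_algebra {a, b})\<lparr>carrier := poly_homogeneous {a, b} n\<rparr>)"
    (is "linearly_isomorphic _ ?V ?W")
  unfolding linearly_isomorphic_def
proof (intro exI conjI)
  have sub: "envelope_component J {a, b} n \<subseteq> carrier U"
    by (auto simp: envelope_component_def carrier_U free_homogeneous_carrier)
  have into: "abelianize X \<in> poly_homogeneous {a, b} n"
    if "X \<in> envelope_component J {a, b} n" for X
    using that
    by (auto simp: envelope_component_def abelianize_cls free_homogeneous_carrier
        push_content_homogeneous)
  show "linear_map class_ring ?V ?W abelianize"
  proof -
    have V: "vectorspace class_ring ?V"
      by (rule U.subspace_is_vs[OF subspace_component])
    have W: "vectorspace class_ring ?W" by (rule vectorspace_poly_homogeneous)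
    have "abelianize \<in> LinearCombinations.module_hom class_ring ?V ?W"
      using into sub
      by (auto simp: LinearCombinations.module_hom_def poly_algebra_def abelianize_add abelianize_smult subset_iff)
    then show ?thesis
      using V W unfolding linear_map_def mod_hom_def mod_hom_axioms_def vectorspace_def by blast
  qed
  show "bij_betw abelianize (carrier ?V) (carrier ?W)"
    unfolding bij_betw_def
  proof
    show "inj_on abelianize (carrier ?V)"
    proof (rule inj_onI)
      fix X Y assume "X \<in> carrier ?V" "Y \<in> carrier ?V" and eq: "abelianize X = abelianize Y"
      then obtain p q where p: "p \<in> free_homogeneous {a, b} n" "X = cls p"
        and q: "q \<in> free_homogeneous {a, b} n" "Y = cls q"
        by (auto simp: envelope_component_def)
      have "p - q \<in> free_homogeneous {a, b} n"
        using free_homogeneous_closed(3)[OF p(1) free_homogeneous_closed(4)[OF q(1)]] by simp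
      moreover have "push content (p - q) = 0"
        using eq p q by (simp add: push_diff abelianize_cls free_homogeneous_carrier)
      ultimately have "p - q \<in> I"
        using ideal_if_push_content_eq_zero assms by blast
      then show "X = Y"
        using p q cls_eq_iff free_homogeneous_carrier by blast
    qed
    show "abelianize ` carrier ?V = carrier ?W"
    proof (intro equalityI subsetI)
      fix g assume "g \<in> carrier ?W"
      then have g: "Poly_Mapping.keys m \<subseteq> {a, b}"
        "int (\<Sum>x\<in>Poly_Mapping.keys m. Poly_Mapping.lookup m x) = n"
        if "m \<in> Poly_Mapping.keys g" for m
        using that by (auto simp: poly_homogeneous_iff)
      \<comment> \<open>The preimage of \<open>g\<close> replaces each monomial by its sorted word,
        whose length is the degree of the monomial.\<close>
      have "set w \<subseteq> {a, b} \<and> int (length w) = n"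
        if w: "w \<in> Poly_Mapping.keys (push sorted_word g)" for w
      proof -
        obtain m where m: "m \<in> Poly_Mapping.keys g" "w = sorted_word m"
          using keys_push[of sorted_word g] w by blast
        then have "content w = m" using content_sorted_word g by blast
        then show ?thesis
          using g(2)[OF m(1)] degree_content[of w] set_sorted_word[of m] m(2)
          by (simp del: of_nat_sum)
      qed
      then have hom: "push sorted_word g \<in> free_homogeneous {a, b} n"
        by (auto simp: free_homogeneous_def free_algebra_simps(1))
      moreover have "push (content \<circ> sorted_word) g = g"
        using g by (intro push_eq_self) (simp add: content_sorted_word)
      ultimately have "abelianize (cls (push sorted_word g)) = g"
        by (simp add: abelianize_cls free_homogeneous_carrier push_push)
      then show "g \<in> abelianize ` carrier ?V"
        using hom by (force simp: envelope_component_def)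
    qed (use into in auto)
  qed
qed

end

section \<open>The relators of the two-dimensional system\<close>

text \<open>Both matrices send the fourth coordinate vector into the span of the first two, that
  span into the line of the third, and that line to zero. Products of three of them therefore
  vanish, and with them all anti-tetrads.\<close>

lemma envelope_relators_D_minus_2_1:
  fixes a b :: "'f::field mat"
  assumes char: "CHAR('f) \<noteq> 2"
    and a: "a = mat_of_rows_list 4 [[0,0,0,-1],[0,0,0,0],[1,0,0,0],[0,0,0,0]]"
    and b: "b = mat_of_rows_list 4 [[0,0,0,0],[0,0,0,-1],[0,1,0,0],[0,0,0,0]]"
  shows "envelope_relators (D_minus 2 1) {a, b} =
    {Poly_Mapping.single [w, x, y, z] 1 - Poly_Mapping.single [z, y, x, w] 1 | w x y z.
      {w, x, y, z} \<subseteq> {a, b}}"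
proof -
  let ?J = "D_minus 2 1 :: ('f, 'f mat) module"
  interpret J: vectorspace "class_ring :: 'f ring" ?J
    by (rule vectorspace_D_minus_2_1[OF assms])
  note num = numeral_eq_Suc less_Suc_eq mat_of_rows_list_def
  \<comment> \<open>With \<open>a = m 1 0\<close> and \<open>b = m 0 1\<close>, one computation with
    parameters covers all triples of letters.\<close>
  define m :: "'f \<Rightarrow> 'f \<Rightarrow> 'f mat" where
    "m s t = mat_of_rows_list 4 [[0,0,0,-s],[0,0,0,-t],[s,t,0,0],[0,0,0,0]]" for s t
  have m: "\<exists>s t. x = m s t" if "x \<in> {a, b}" for x
    using that unfolding a b m_def by (metis insertE neg_equal_0_iff_equal singletonD)
  have "m s t * m s' t' * m s'' t'' = 0\<^sub>m 4 4" for s t s' t' s'' t''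
    by (rule eq_matI) (auto simp: m_def num scalar_prod_def)
  then have triple: "w * x * y = 0\<^sub>m 4 4" if "w \<in> {a, b}" "x \<in> {a, b}" "y \<in> {a, b}" for w x y
    using m[OF that(1)] m[OF that(2)] m[OF that(3)] by fastforce
  have carrier: "z \<in> carrier_mat 4 4" if "z \<in> {a, b}" for z
    using that by (auto simp: a b num)
  have tetrad: "anti_tetrad w x y z = 0\<^sub>m 4 4"
    if "w \<in> {a, b}" "x \<in> {a, b}" "y \<in> {a, b}" "z \<in> {a, b}" for w x y z
    using triple[OF that(1-3)] triple[OF that(4) that(3) that(2)]
      left_mult_zero_mat[OF carrier[OF that(4)]] left_mult_zero_mat[OF carrier[OF that(1)]]
    by (simp add: anti_tetrad_def)
  have zero: "\<zero>\<^bsub>?J\<^esub> = 0\<^sub>m 4 4" by (simp add: D_minus_def module_mat_simps)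
  have basis: "J.basis {a, b}" by (rule basis_D_minus_2_1[OF assms])
  then have ab: "{a, b} \<subseteq> carrier ?J" and indpt: "J.lin_indpt {a, b}"
    unfolding J.basis_def by blast+
  \<comment> \<open>A relator admits any \<open>c\<close> that represents the anti-tetrad. As that
    is zero, independence of the basis forces \<open>c\<close> to vanish on it, and the linear part
    of the relator disappears.\<close>
  have lincomb: "J.lincomb c {a, b} = \<zero>\<^bsub>?J\<^esub> \<longleftrightarrow> (\<forall>v\<in>{a, b}. c v = 0)" for c
  proof
    assume "J.lincomb c {a, b} = \<zero>\<^bsub>?J\<^esub>"
    then show "\<forall>v\<in>{a, b}. c v = 0"
      using J.lin_dep_crit[of "{a, b}" "{a, b}" c] indpt by auto
  next
    assume "\<forall>v\<in>{a, b}. c v = 0"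
    then show "J.lincomb c {a, b} = \<zero>\<^bsub>?J\<^esub>"
      using ab J.smult_l_null[of a] J.smult_l_null[of b]
      unfolding J.lincomb_def by (intro J.M.finsum_all0) auto
  qed
  show ?thesis
  proof (intro equalityI subsetI)
    fix r assume "r \<in> envelope_relators ?J {a, b}"
    then obtain w x y z c where mem: "w \<in> {a, b}" "x \<in> {a, b}" "y \<in> {a, b}" "z \<in> {a, b}"
      and r: "r = Poly_Mapping.single [w, x, y, z] 1 - Poly_Mapping.single [z, y, x, w] 1
        - (\<Sum>v\<in>{a, b}. Poly_Mapping.single [v] (c v))"
      and c: "anti_tetrad w x y z = J.lincomb c {a, b}"
      unfolding envelope_relators_def by blast
    have "\<forall>v\<in>{a, b}. c v = 0"
      using c tetrad[OF mem] zero lincomb[of c] by argo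
    then have "(\<Sum>v\<in>{a, b}. Poly_Mapping.single [v] (c v)) = 0"
      by (intro sum.neutral) simp
    then show "r \<in> {Poly_Mapping.single [w, x, y, z] 1 - Poly_Mapping.single [z, y, x, w] 1 |
        w x y z. {w, x, y, z} \<subseteq> {a, b}}"
      using r mem by auto
  next
    fix r :: "'f mat list \<Rightarrow>\<^sub>0 'f"
    assume "r \<in> {Poly_Mapping.single [w, x, y, z] 1 - Poly_Mapping.single [z, y, x, w] 1 |
        w x y z. {w, x, y, z} \<subseteq> {a, b}}"
    then obtain w x y z where mem: "w \<in> {a, b}" "x \<in> {a, b}" "y \<in> {a, b}" "z \<in> {a, b}"
      and r: "r = Poly_Mapping.single [w, x, y, z] 1 - Poly_Mapping.single [z, y, x, w] 1"
      by auto
    define c :: "'f mat \<Rightarrow> 'f" where "c = (\<lambda>_. 0)"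
    have "anti_tetrad w x y z = J.lincomb c {a, b}"
      using tetrad[OF mem] zero lincomb[of c] by (simp add: c_def)
    moreover have "r = Poly_Mapping.single [w, x, y, z] 1 - Poly_Mapping.single [z, y, x, w] 1
        - (\<Sum>v\<in>{a, b}. Poly_Mapping.single [v] (c v))"
      by (simp add: r c_def)
    ultimately show "r \<in> envelope_relators ?J {a, b}"
      unfolding envelope_relators_def using mem by blast
  qed
qed

theorem proposition8p1:
  fixes a b :: "'f::field mat"
    and J :: "('f, 'f mat) module"
    and U :: "('f, ('f mat list \<Rightarrow>\<^sub>0 'f) set) module"
    and U_deg :: "int \<Rightarrow> ('f mat list \<Rightarrow>\<^sub>0 'f) set set"
  assumes "CHAR('f) = 0 \<or> CHAR('f) > 7"
    and "a = mat_of_rows_list 4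
      [[0, 0, 0, -1],
       [0, 0, 0,  0],
       [1, 0, 0,  0],
       [0, 0, 0,  0]]"
    and "b = mat_of_rows_list 4
      [[0, 0, 0,  0],
       [0, 0, 0, -1],
       [0, 1, 0,  0],
       [0, 0, 0,  0]]"
    and "J = D_minus 2 1"
    and "U = universal_envelope J {a, b}"
    and "U_deg = envelope_component J {a, b}"
  shows "Z_graded_algebra class_ring U U_deg
    \<and> envelope_class J {a, b} (Poly_Mapping.single [a] 1) \<in> U_deg 1
    \<and> envelope_class J {a, b} (Poly_Mapping.single [b] 1) \<in> U_deg 1
    \<and> \<not> vectorspace.fin_dim class_ring U
    \<and> (\<forall>n\<ge>6. linearly_isomorphic class_ring
          (U\<lparr>carrier := U_deg n\<rparr>)
          ((poly_algebra {a, b})\<lparr>carrier := poly_homogeneous {a, b} n\<rparr>))"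
proof -
  \<comment> \<open>In characteristic other than two the skew-symmetric 1 by 1 block is zero; this
    is what makes \<open>{a, b}\<close> a basis of \<open>D_minus 2 1\<close>.\<close>
  have char: "CHAR('f) \<noteq> 2" using assms(1) by auto
  have rel: "envelope_relators J {a, b} =
    {Poly_Mapping.single [w, x, y, z] 1 - Poly_Mapping.single [z, y, x, w] 1 | w x y z.
      {w, x, y, z} \<subseteq> {a, b}}"
    unfolding assms(4) by (rule envelope_relators_D_minus_2_1[OF char assms(2,3)])
  \<comment> \<open>This entry is 1 in \<open>a\<close> and 0 in \<open>b\<close>, so the two
    letters are distinct.\<close>
  have "a $$ (2, 0) \<noteq> b $$ (2, 0)"
    unfolding assms(2,3) by (simp add: mat_of_rows_list_def numeral_eq_Suc)
  then interpret reversal_envelope J a b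
    using rel by unfold_locales auto
  have "envelope_class J {a, b} (Poly_Mapping.single [x] 1) \<in> U_deg 1" if "x \<in> {a, b}" for x
    unfolding assms(6) envelope_component_def using that
    by (intro imageI) (simp add: free_homogeneous_def free_algebra_simps(1))
  then show ?thesis
    unfolding assms(5,6)
    using Z_graded_algebra_U not_fin_dim_U linearly_isomorphic_component by auto
qed

end
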